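(* There is an absolute constant $C$ such that for every $n\ge 1$ and every $m$: if $\Gamma: M_n(GF(2))\to GF(2)^m$ is a linear code of matrices, then $m\ge 3n^2 - Cn^{5/3}$.
   Context: $M_n(GF(2))$ denotes the $n\times n$ matrices over $GF(2)$. For $v\in GF(2)^m$, $\mathrm{weight}(v)$ is the number of nonzero coordinates of $v$. A linear code of matrices is a map $\Gamma:M_n(GF(2))\to GF(2)^m$ that is $GF(2)$-linear and satisfies $\mathrm{weight}(\Gamma(a))\ge n\cdot \mathrm{rank}(a)$ for every $a\in M_n(GF(2))$. *)

theory Defs
  imports Complex_Main "HOL-Library.Z2" "Jordan_Normal_Form.DL_Rank"
begin

definition weight :: "bit vec \<Rightarrow> nat" where
  "weight v = card {i. i < dim_vec v \<and> v $ i \<noteq> 0}"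

text \<open>The dimensions are natural numbers rather than types because the constant in the
  main bound must not depend on them.\<close>

definition linear_code_of_matrices :: "nat \<Rightarrow> nat \<Rightarrow> (bit mat \<Rightarrow> bit vec) \<Rightarrow> bool" where
  "linear_code_of_matrices n m \<Gamma> \<longleftrightarrow>
     linear_map class_ring (module_mat TYPE(bit) n n) (module_vec TYPE(bit) m) \<Gamma> \<and>
     (\<forall>a \<in> carrier_mat n n. weight (\<Gamma> a) \<ge> n * vec_space.rank n a)"

end

theory Submission
  imports Defs "Jordan_Normal_Form.DL_Rank_Submatrix"
begin

text \<open>Since \<open>\<Gamma>\<close> is injective, some set \<open>I\<close> of \<open>n\<^sup>2\<close> coordinates determines matrices bijectively.
  Let \<open>a\<^sub>j\<close>, for \<open>j < k\<close>, be \<open>k\<close> unknown matrices, parametrised by their \<open>I\<close>-coordinates.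
  For every nonempty \<open>c \<subseteq> {..<k}\<close> consider a minor of size \<open>n - k\<close> of \<open>\<Sum>j\<in>c. a\<^sub>j\<close>.
  The product of these minors is a polynomial over GF(2) of degree at most \<open>(2^k - 1) * n\<close>, and it
  does not vanish at the powers of the shift matrix. A nonzero polynomial function of degree \<open>d\<close>
  over GF(2) is nonzero at some point of weight at most \<open>d\<close>. Hence there are \<open>a\<^sub>j\<close> all of whose nonzero
  combinations have rank at least \<open>n - k\<close>, while their codewords vanish on \<open>I\<close> outside a set of size
  at most \<open>(2^k - 1) * n\<close>. Averaging the weights of these combinations (Plotkin's argument) over the
  at most \<open>m - n\<^sup>2 + (2^k - 1) * n\<close> remaining coordinates bounds \<open>m\<close>, and taking \<open>2^k\<close> of order \<open>\<surd>n\<close>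
  gives \<open>m \<ge> 3 * n\<^sup>2 - O(n powr (3/2))\<close>.\<close>

section \<open>Polynomial functions over GF(2), with \<open>bit\<close> arithmetic kept in ring
  form\<close>

declare add_bit_eq_xor [simp del] mult_bit_eq_and [simp del]

lemma bit_add_self [simp]: "(x::bit) + x = 0"
  by (cases x) (simp_all add: add_bit_eq_xor)

text \<open>A point of \<open>GF(2)\<^sup>X\<close> is given by its support \<open>Y\<close>, so \<open>of_bool (A \<subseteq> Y)\<close> is the monomial
  \<open>\<Prod>x\<in>A. x\<close>; \<open>boolean_poly d\<close> are the functions of degree at most \<open>d\<close>.\<close>

inductive boolean_poly :: "nat \<Rightarrow> ('x set \<Rightarrow> bit) \<Rightarrow> bool" for d where
  zero: "boolean_poly d (\<lambda>_. 0)"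
| add_monom: "\<lbrakk>finite A; card A \<le> d; boolean_poly d f\<rbrakk>
    \<Longrightarrow> boolean_poly d (\<lambda>Y. of_bool (A \<subseteq> Y) + f Y)"

lemma boolean_poly_monom:
  assumes "finite A" "card A \<le> d"
  shows "boolean_poly d (\<lambda>Y. of_bool (A \<subseteq> Y))"
  using boolean_poly.add_monom[OF assms boolean_poly.zero] by simp

lemma boolean_poly_const: "boolean_poly d (\<lambda>_. c)"
  using boolean_poly_monom[of "{}" d] boolean_poly.zero[of d] by (cases c) auto

lemma boolean_poly_mono:
  assumes "boolean_poly d f" "d \<le> e"
  shows "boolean_poly e f"
  using assms by induction (auto intro: boolean_poly.intros)

lemma boolean_poly_add:
  assumes "boolean_poly d f" "boolean_poly d g"
  shows "boolean_poly d (\<lambda>Y. f Y + g Y)"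
  using assms by induction (auto simp: add.assoc intro: boolean_poly.intros)

lemma boolean_poly_sum:
  assumes "\<And>s. s \<in> S \<Longrightarrow> boolean_poly d (f s)"
  shows "boolean_poly d (\<lambda>Y. \<Sum>s\<in>S. f s Y)"
  using assms
  by (induction S rule: infinite_finite_induct)
     (auto intro: boolean_poly.zero boolean_poly_add)

text \<open>Since \<open>x * x = x\<close> on GF(2), the monomials of \<open>A\<close> and
  \<open>B\<close> multiply to that of \<open>A \<union> B\<close>, whose degree may be less than
  the sum of the degrees.\<close>

lemma boolean_poly_monom_mult:
  assumes "finite A" "card A \<le> d" "boolean_poly e f"
  shows "boolean_poly (d + e) (\<lambda>Y. of_bool (A \<subseteq> Y) * f Y)"
  using assms(3)
proof induction
  case zero
  show ?case by (simp add: boolean_poly.zero)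
next
  case (add_monom B f)
  have "card (A \<union> B) \<le> d + e"
    using assms(2) add_monom(2) card_Un_le[of A B] by linarith
  then have "boolean_poly (d + e) (\<lambda>Y. of_bool (A \<union> B \<subseteq> Y) + of_bool (A \<subseteq> Y) * f Y)"
    using add_monom assms by (intro boolean_poly.add_monom) auto
  then show ?case
    by (simp add: distrib_left flip: of_bool_conj)
qed

lemma boolean_poly_mult:
  assumes "boolean_poly d f" "boolean_poly e g"
  shows "boolean_poly (d + e) (\<lambda>Y. f Y * g Y)"
  using assms(1)
proof induction
  case zero
  show ?case by (simp add: boolean_poly.zero)
next
  case (add_monom A f)
  then show ?case
    using boolean_poly_add[OF boolean_poly_monom_mult[OF add_monom(1,2) assms(2)]]
    by (simp add: distrib_right)
qed

lemma boolean_poly_prod: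
  assumes "finite S" "\<And>s. s \<in> S \<Longrightarrow> boolean_poly (d s) (f s)"
  shows "boolean_poly (\<Sum>s\<in>S. d s) (\<lambda>Y. \<Prod>s\<in>S. f s Y)"
  using assms
  by (induction S rule: finite_induct) (auto intro: boolean_poly_const boolean_poly_mult)

text \<open>In the Leibniz expansion each permutation contributes a constant sign times
  \<open>r\<close> factors of degree at most one.\<close>

lemma boolean_poly_det:
  assumes "\<And>p q. p < r \<Longrightarrow> q < r \<Longrightarrow> boolean_poly 1 (\<lambda>Y. f p q Y)"
  shows "boolean_poly r (\<lambda>Y. det (mat r r (\<lambda>(p, q). f p q Y)))"
proof -
  have "boolean_poly (0 + (\<Sum>i\<in>{0..<r}. 1))
      (\<lambda>Y. signof \<pi> * (\<Prod>i\<in>{0..<r}. f i (\<pi> i) Y))" if "\<pi> permutes {0..<r}" for \<pi>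
    using permutes_in_image[OF that]
    by (intro boolean_poly_mult boolean_poly_const boolean_poly_prod assms) auto
  then have "boolean_poly r (\<lambda>Y. \<Sum>\<pi> | \<pi> permutes {0..<r}.
      signof \<pi> * (\<Prod>i\<in>{0..<r}. f i (\<pi> i) Y))"
    by (intro boolean_poly_sum) simp
  also have "(\<lambda>Y. \<Sum>\<pi> | \<pi> permutes {0..<r}. signof \<pi> * (\<Prod>i\<in>{0..<r}. f i (\<pi> i) Y)) =
      (\<lambda>Y. det (mat r r (\<lambda>(p, q). f p q Y)))"
  proof
    fix Y
    show "(\<Sum>\<pi> | \<pi> permutes {0..<r}. signof \<pi> * (\<Prod>i\<in>{0..<r}. f i (\<pi> i) Y)) =
        det (mat r r (\<lambda>(p, q). f p q Y))"
      unfolding det_def'[OF mat_carrier]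
      by (intro sum.cong prod.cong arg_cong2[where f = "(*)"] refl)
         (auto simp: permutes_in_image)
  qed
  finally show ?thesis .
qed

section \<open>Nonzero values at points of small weight\<close>

lemma sum_Pow_insert:
  assumes "finite W" "y \<notin> W"
  shows "(\<Sum>Z\<in>Pow (insert y W). h Z) = (\<Sum>Z\<in>Pow W. h Z + h (insert y Z))"
proof -
  have "inj_on (insert y) (Pow W)"
    using assms(2) by (auto simp: inj_on_def)
  moreover have "Pow W \<inter> insert y ` Pow W = {}"
    using assms(2) by auto
  ultimately show ?thesis
    using assms(1) by (simp add: Pow_insert sum.union_disjoint sum.reindex sum.distrib)
qed

text \<open>A monomial \<open>A\<close> with \<open>card A \<le> d\<close> misses some
  \<open>y\<close> in \<open>Y\<close>. Toggling \<open>y\<close> pairs the subsets of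
  \<open>Y\<close> without changing the value of the monomial, so the values cancel in
  characteristic 2.\<close>

lemma boolean_poly_sum_Pow:
  assumes "boolean_poly d f" "finite Y" "d < card Y"
  shows "(\<Sum>Z\<in>Pow Y. f Z) = 0"
  using assms
proof induction
  case zero
  show ?case by simp
next
  case (add_monom A f)
  have "\<not> Y \<subseteq> A"
    using add_monom card_mono[of A Y] by linarith
  then obtain y where y: "y \<in> Y" "y \<notin> A" by auto
  have "(\<Sum>Z\<in>Pow (insert y (Y - {y})). of_bool (A \<subseteq> Z) :: bit) =
      (\<Sum>Z\<in>Pow (Y - {y}). of_bool (A \<subseteq> Z) + of_bool (A \<subseteq> insert y Z))"
    using add_monom by (intro sum_Pow_insert) auto
  also have "\<dots> = 0"
    using y by (simp add: subset_insert)
  finally show ?case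
    using add_monom y by (simp add: sum.distrib insert_absorb)
qed

text \<open>While \<open>card Y > d\<close>, the values over all subsets of \<open>Y\<close> sum to
  zero, so a nonzero \<open>f Y\<close> forces a nonzero value at a proper subset. Descend until the
  size is at most \<open>d\<close>.\<close>

lemma boolean_poly_nonzero_small:
  assumes "boolean_poly d f" "finite Y" "f Y \<noteq> 0"
  shows "\<exists>Z\<subseteq>Y. card Z \<le> d \<and> f Z \<noteq> 0"
  using assms(2,3)
proof (induction Y rule: finite_psubset_induct)
  case (psubset Y)
  show ?case
  proof (cases "card Y \<le> d")
    case True
    then show ?thesis using psubset by blast
  next
    case False
    have "0 = (\<Sum>Z\<in>Pow Y. f Z)"
      using boolean_poly_sum_Pow[OF assms(1) psubset(1)] False by simp
    also have "\<dots> = f Y + (\<Sum>Z\<in>Pow Y - {Y}. f Z)"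
      using psubset(1) by (subst sum.remove[of _ Y]) auto
    finally have "(\<Sum>Z\<in>Pow Y - {Y}. f Z) \<noteq> 0"
      using psubset.prems by (metis add.right_neutral)
    then obtain Z where "Z \<in> Pow Y - {Y}" "f Z \<noteq> 0"
      by (meson sum.neutral)
    then show ?thesis
      using psubset.IH[of Z] by blast
  qed
qed

section \<open>Parity counting for Plotkin's argument\<close>

text \<open>If some \<open>v j\<close> is 1, toggling \<open>j\<close> changes the parity of the sum
  and injects the odd subsets into the even ones; otherwise there are no odd subsets.\<close>

lemma card_odd_subsets_le:
  fixes v :: "'j \<Rightarrow> bit"
  assumes "finite K"
  shows "2 * card {c \<in> Pow K. (\<Sum>j\<in>c. v j) \<noteq> 0} \<le> 2 ^ card K"
proof (cases "\<exists>j\<in>K. v j \<noteq> 0")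
  case False
  then have "{c \<in> Pow K. (\<Sum>j\<in>c. v j) \<noteq> 0} = {}"
    by (auto intro!: sum.neutral)
  then show ?thesis by (metis card.empty mult_0_right zero_le)
next
  case True
  then obtain j where j: "j \<in> K" "v j = 1" by auto
  define flip where "flip c = (if j \<in> c then c - {j} else insert j c)" for c
  have flip_flip: "flip (flip c) = c" for c
    by (auto simp: flip_def)
  have flip_subset: "flip c \<subseteq> K" if "c \<subseteq> K" for c
    using that j(1) by (auto simp: flip_def)
  have sum_flip: "(\<Sum>i\<in>flip c. v i) = (\<Sum>i\<in>c. v i) + 1" if "c \<subseteq> K" for c
  proof -
    have fin: "finite c" using that assms finite_subset by blast
    show ?thesis
    proof (cases "j \<in> c")
      case True
      then show ?thesis
        using fin j by (simp add: flip_def sum.remove[of c j] add.commute add.left_commute)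
    qed (use fin j in \<open>simp add: flip_def add.commute\<close>)
  qed
  let ?O = "{c \<in> Pow K. (\<Sum>j\<in>c. v j) \<noteq> 0}" and ?E = "{c \<in> Pow K. (\<Sum>j\<in>c. v j) = 0}"
  have "flip ` ?O \<subseteq> ?E"
    using sum_flip flip_subset by auto
  moreover have "inj_on flip ?O"
    by (rule inj_on_inverseI[of _ flip]) (rule flip_flip)
  ultimately have "card ?O \<le> card ?E"
    using assms by (intro card_inj_on_le) auto
  moreover have "card ?O + card ?E = card (Pow K)"
    using assms by (subst card_Un_disjoint[symmetric]) (auto intro!: arg_cong[where f = card])
  ultimately show ?thesis
    using assms by (simp add: card_Pow)
qed

section \<open>Additive functionals on matrices and information sets\<close>

text \<open>The format is fixed by \<open>n\<close>, so the empty sum is the \<open>n\<close> by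
  \<open>n\<close> zero matrix.\<close>

definition matrix_sum :: "nat \<Rightarrow> ('w \<Rightarrow> 'a::comm_monoid_add mat) \<Rightarrow> 'w set \<Rightarrow> 'a mat" where
  "matrix_sum n B W = mat n n (\<lambda>(p, q). \<Sum>w\<in>W. B w $$ (p, q))"

lemma matrix_sum_carrier [simp]: "matrix_sum n B W \<in> carrier_mat n n"
  by (simp add: matrix_sum_def)

text \<open>Over GF(2) the only scalars are 0 and 1, so additivity amounts to linearity.\<close>

definition additive_on_matrices :: "nat \<Rightarrow> ('a::comm_monoid_add mat \<Rightarrow> 'a) \<Rightarrow> bool" where
  "additive_on_matrices n g \<longleftrightarrow>
    (\<forall>a\<in>carrier_mat n n. \<forall>b\<in>carrier_mat n n. g (a + b) = g a + g b)"

lemma additive_on_matrices_add: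
  assumes "additive_on_matrices n g" "a \<in> carrier_mat n n" "b \<in> carrier_mat n n"
  shows "g (a + b) = g a + g b"
  using assms by (simp add: additive_on_matrices_def)

lemma additive_on_matrices_zero:
  fixes g :: "bit mat \<Rightarrow> bit"
  assumes "additive_on_matrices n g"
  shows "g (0\<^sub>m n n) = 0"
  using additive_on_matrices_add[OF assms zero_carrier_mat zero_carrier_mat] by simp

lemma additive_on_matrices_sum:
  fixes g :: "bit mat \<Rightarrow> bit"
  assumes g: "additive_on_matrices n g" and "finite W" "\<And>w. w \<in> W \<Longrightarrow> B w \<in> carrier_mat n n"
  shows "g (matrix_sum n B W) = (\<Sum>w\<in>W. g (B w))"
  using assms(2,3)
proof (induction W rule: finite_induct)
  case empty
  have "matrix_sum n B {} = 0\<^sub>m n n"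
    by (auto simp: matrix_sum_def)
  then show ?case
    using additive_on_matrices_zero[OF g] by simp
next
  case (insert w W)
  then have "matrix_sum n B (insert w W) = B w + matrix_sum n B W"
    by (intro eq_matI) (auto simp: matrix_sum_def)
  then show ?case
    using insert additive_on_matrices_add[OF g] by simp
qed

lemma bit_mat_add_eq_0_imp_eq:
  fixes a b :: "bit mat"
  assumes "a \<in> carrier_mat n n" "b \<in> carrier_mat n n" "a + b = 0\<^sub>m n n"
  shows "a = b"
proof (rule eq_matI)
  fix p q assume "p < dim_row b" "q < dim_col b"
  then have "a $$ (p, q) + b $$ (p, q) = 0"
    using assms index_add_mat(1)[of p b q a] by simp
  then have "a $$ (p, q) + b $$ (p, q) + b $$ (p, q) = b $$ (p, q)" by simp
  then show "a $$ (p, q) = b $$ (p, q)" by (simp add: add.assoc)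
qed (use assms in auto)

text \<open>The functionals \<open>g i\<close> with \<open>i \<in> I\<close> form a basis of the
  dual space, and \<open>B\<close> is the basis of matrices dual to it.\<close>

lemma information_set_exists:
  fixes g :: "nat \<Rightarrow> bit mat \<Rightarrow> bit"
  assumes add: "\<And>i. i < m \<Longrightarrow> additive_on_matrices n (g i)"
    and inj: "\<And>a. a \<in> carrier_mat n n \<Longrightarrow> (\<And>i. i < m \<Longrightarrow> g i a = 0) \<Longrightarrow> a = 0\<^sub>m n n"
  obtains I B where "I \<subseteq> {..<m}" "n * n \<le> card I"
    "\<And>i. i \<in> I \<Longrightarrow> B i \<in> carrier_mat n n"
    "\<And>i j. i \<in> I \<Longrightarrow> j \<in> I \<Longrightarrow> g j (B i) = of_bool (i = j)"
    "\<And>a. a \<in> carrier_mat n n \<Longrightarrow> a = matrix_sum n B {i \<in> I. g i a \<noteq> 0}"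
proof -
  \<comment> \<open>A maximal set of coordinates onto which the map is surjective is an information set.\<close>
  define onto where "onto I \<longleftrightarrow> I \<subseteq> {..<m} \<and>
      (\<forall>Y\<subseteq>I. \<exists>a\<in>carrier_mat n n. \<forall>i\<in>I. g i a = of_bool (i \<in> Y))" for I
  have "onto {}"
    by (auto simp: onto_def)
  moreover have "\<forall>I. onto I \<longrightarrow> card I < Suc m"
    by (auto simp: onto_def less_Suc_eq_le dest!: card_mono[rotated])
  ultimately obtain I where I: "onto I" "\<And>J. onto J \<Longrightarrow> card J \<le> card I"
    using ex_has_greatest_nat[of onto "{}" card "Suc m"] by auto
  then have sub: "I \<subseteq> {..<m}" and fin: "finite I"
    using finite_subset by (auto simp: onto_def)
  \<comment> \<open>If \<open>a\<close> vanishes on \<open>I\<close> but \<open>g j a\<close> is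
    nonzero, adding \<open>a\<close> changes coordinate \<open>j\<close> and none in
    \<open>I\<close>. Then \<open>insert j I\<close> would be onto as well, against
    maximality.\<close>
  have ker: "a = 0\<^sub>m n n" if a: "a \<in> carrier_mat n n" "\<And>i. i \<in> I \<Longrightarrow> g i a = 0" for a
  proof (rule inj[OF a(1)], rule ccontr)
    fix j assume j: "j < m" "g j a \<noteq> 0"
    then have jI: "j \<notin> I" using a by auto
    have "onto (insert j I)"
      unfolding onto_def
    proof (intro conjI allI impI)
      show "insert j I \<subseteq> {..<m}" using sub j by simp
      fix Y assume "Y \<subseteq> insert j I"
      obtain b where b: "b \<in> carrier_mat n n" "\<forall>i\<in>I. g i b = of_bool (i \<in> Y \<inter> I)"
        using I(1) unfolding onto_def by (meson inf_le2)
      show "\<exists>a\<in>carrier_mat n n. \<forall>i\<in>insert j I. g i a = of_bool (i \<in> Y)"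
      proof (cases "g j b = of_bool (j \<in> Y)")
        case True
        then show ?thesis using b by (intro bexI[of _ b]) auto
      next
        case False
        have gadd: "g i (b + a) = g i b + g i a" if "i \<in> insert j I" for i
          using that sub j b a by (intro additive_on_matrices_add[OF add]) auto
        show ?thesis
        proof (intro bexI[of _ "b + a"] ballI)
          fix i assume i: "i \<in> insert j I"
          show "g i (b + a) = of_bool (i \<in> Y)"
          proof (cases "i = j")
            case True
            then show ?thesis using gadd[OF i] j False by (cases "j \<in> Y") auto
          qed (use i b a gadd[OF i] in auto)
        qed (use a b in auto)
      qed
    qed
    then have "card (insert j I) \<le> card I" by (rule I(2))
    then show False using jI fin by simp
  qed
  have eqI: "a = b" if "a \<in> carrier_mat n n" "b \<in> carrier_mat n n" "\<And>i. i \<in> I \<Longrightarrow> g i a = g i b"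
    for a b
  proof (rule bit_mat_add_eq_0_imp_eq[OF that(1,2)], rule ker)
    fix i assume "i \<in> I"
    then show "g i (a + b) = 0"
      using that sub additive_on_matrices_add[OF add that(1,2)] by auto
  qed (use that in auto)
  \<comment> \<open>The lower bound on \<open>card I\<close> comes from counting: \<open>E\<close>
    lists the 2^(n^2) matrices by their supports, and the coordinates in \<open>I\<close> tell them
    apart.\<close>
  define E :: "(nat \<times> nat) set \<Rightarrow> bit mat" where
    "E Z = mat n n (\<lambda>x. of_bool (x \<in> Z))" for Z
  let ?S = "{..<n} \<times> {..<n}" and ?\<phi> = "\<lambda>Z. {i \<in> I. g i (E Z) \<noteq> 0}"
  have "inj_on ?\<phi> (Pow ?S)"
  proof (rule inj_onI)
    fix Z Z' assume Z: "Z \<in> Pow ?S" "Z' \<in> Pow ?S" and eq: "?\<phi> Z = ?\<phi> Z'"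
    have "E Z = E Z'"
    proof (rule eqI)
      fix i assume i: "i \<in> I"
      have "i \<in> ?\<phi> Z \<longleftrightarrow> i \<in> ?\<phi> Z'"
        by (simp only: eq)
      then show "g i (E Z) = g i (E Z')"
        using i by (cases "g i (E Z)"; cases "g i (E Z')") auto
    qed (simp_all add: E_def)
    have "x \<in> Z \<longleftrightarrow> x \<in> Z'" if "x \<in> ?S" for x
      using arg_cong[OF \<open>E Z = E Z'\<close>, of "\<lambda>M. M $$ x"] that by (auto simp: E_def)
    then show "Z = Z'" using Z by blast
  qed
  then have "card (Pow ?S) \<le> card (Pow I)"
    using fin by (intro card_inj_on_le[where f = ?\<phi>]) auto
  then have card: "n * n \<le> card I"
    using fin by (simp add: card_Pow)
  have "\<forall>i\<in>I. \<exists>b. b \<in> carrier_mat n n \<and> (\<forall>j\<in>I. g j b = of_bool (j \<in> {i}))"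
    using I(1) unfolding onto_def by (metis empty_subsetI insert_subset)
  then obtain B where "\<forall>i\<in>I. B i \<in> carrier_mat n n \<and> (\<forall>j\<in>I. g j (B i) = of_bool (j \<in> {i}))"
    by (auto dest!: bchoice)
  then have B: "\<And>i. i \<in> I \<Longrightarrow> B i \<in> carrier_mat n n"
      "\<And>i j. i \<in> I \<Longrightarrow> j \<in> I \<Longrightarrow> g j (B i) = of_bool (i = j)"
    by auto
  have "a = matrix_sum n B {i \<in> I. g i a \<noteq> 0}" if a: "a \<in> carrier_mat n n" for a
  proof (rule eqI[OF a])
    fix j assume j: "j \<in> I"
    have "g j (matrix_sum n B {i \<in> I. g i a \<noteq> 0}) = (\<Sum>i | i \<in> I \<and> g i a \<noteq> 0. g j (B i))"
      using j sub B fin by (intro additive_on_matrices_sum[OF add]) auto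
    also have "\<dots> = (\<Sum>i | i \<in> I \<and> g i a \<noteq> 0. if i = j then 1 else 0)"
      using j B by (intro sum.cong) auto
    also have "\<dots> = g j a"
      using j fin by (simp add: sum.delta)
    finally show "g j a = g j (matrix_sum n B {i \<in> I. g i a \<noteq> 0})" ..
  qed simp
  then show ?thesis
    using that[OF sub card B] by blast
qed

section \<open>Minors, rank and sparse families of high rank\<close>

text \<open>The determinant is the minor on the first \<open>r\<close> rows and the \<open>r\<close>
  consecutive columns starting at \<open>l\<close>.\<close>

lemma rank_ge_shifted_minor:
  fixes A :: "'a::field mat"
  assumes A: "A \<in> carrier_mat n n" and le: "r + l \<le> n"
    and det: "det (mat r r (\<lambda>(p, q). A $$ (p, q + l))) \<noteq> 0"
  shows "r \<le> vec_space.rank n A"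
proof -
  have set1: "{i. i < n \<and> i \<in> {..<r}} = {..<r}" and set2: "{j. j < n \<and> j \<in> {l..<l + r}} = {l..<l + r}"
    using le by auto
  have "submatrix A {..<r} {l..<l + r} = mat r r (\<lambda>(p, q). A $$ (p, q + l))"
  proof (rule eq_matI)
    fix p q
    assume "p < dim_row (mat r r (\<lambda>(p, q). A $$ (p, q + l)))"
      and "q < dim_col (mat r r (\<lambda>(p, q). A $$ (p, q + l)))"
    then have pq: "p < r" "q < r" by auto
    \<comment> \<open>\<open>submatrix\<close> numbers its rows and columns by how many selected
      indices are smaller.\<close>
    have "{a \<in> {..<r}. a < p} = {..<p}" "{a \<in> {l..<l + r}. a < q + l} = {l..<q + l}"
      using pq by auto
    then have "submatrix A {..<r} {l..<l + r} $$ (p, q) = A $$ (p, q + l)"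
      using submatrix_index_card[of p A "q + l" "{..<r}" "{l..<l + r}"] A pq le by simp
    then show "submatrix A {..<r} {l..<l + r} $$ (p, q) =
        mat r r (\<lambda>(p, q). A $$ (p, q + l)) $$ (p, q)"
      using pq by simp
  qed (use A set1 set2 in \<open>simp_all add: dim_submatrix\<close>)
  then show ?thesis
    using vec_space.rank_gt_minor[OF A, of "{..<r}" "{l..<l + r}"] det set2 by simp
qed

lemma det_unit_upper_triangular:
  assumes "\<And>p q. p < r \<Longrightarrow> q < p \<Longrightarrow> f p q = 0" "\<And>p. p < r \<Longrightarrow> f p p = 1"
  shows "det (mat r r (\<lambda>(p, q). f p q)) = (1 :: 'a::comm_ring_1)"
proof -
  let ?M = "mat r r (\<lambda>(p, q). f p q)"
  have "upper_triangular ?M"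
    using assms(1) by (auto simp: upper_triangular_def)
  then have "det ?M = prod_list (diag_mat ?M)"
    by (rule det_upper_triangular[OF _ mat_carrier])
  also have "diag_mat ?M = map (\<lambda>_. 1) [0..<r]"
    using assms(2) by (auto simp: diag_mat_def)
  finally show ?thesis
    by (simp add: map_replicate_const)
qed

text \<open>A pair \<open>(j, i)\<close> in \<open>Y\<close> means that \<open>B i\<close> is a
  summand of the \<open>j\<close>-th matrix. The matrix for \<open>c\<close> is thus the sum of the
  \<open>j\<close>-th matrices over \<open>j \<in> c\<close>, and \<open>card Y\<close> is the total
  number of summands.\<close>

lemma sparse_high_rank_family:
  fixes B :: "nat \<Rightarrow> bit mat"
  assumes fin: "finite I"
    and spanning: "\<And>a. a \<in> carrier_mat n n \<Longrightarrow> \<exists>Z\<subseteq>I. a = matrix_sum n B Z"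
  obtains Y where "Y \<subseteq> {..<k} \<times> I" "card Y \<le> (2 ^ k - 1) * n"
    "\<And>c. c \<subseteq> {..<k} \<Longrightarrow> c \<noteq> {} \<Longrightarrow>
      n - k \<le> vec_space.rank n (matrix_sum n (B \<circ> snd) {w \<in> Y. fst w \<in> c})"
proof -
  define r where "r = n - k"
  define U where "U = {..<k} \<times> I"
  define Cs where "Cs = Pow {..<k} - {{}}"
  \<comment> \<open>The entry \<open>(p, q)\<close> of the combination \<open>c\<close>, written as
    a polynomial of degree at most one in the indicator of \<open>Y\<close>.\<close>
  define e where "e c p q Y = (\<Sum>w | w \<in> U \<and> fst w \<in> c. of_bool ({w} \<subseteq> Y) * B (snd w) $$ (p, q))"
    for c p q Y
  \<comment> \<open>\<open>P\<close> is nonzero exactly when all the chosen minors are. The column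
    shift \<open>Min c\<close> is the offset of the first nonzero diagonal when the matrices are
    powers of the shift; it is below \<open>k\<close>, so a minor of size \<open>n - k\<close>
    fits.\<close>
  define P where "P Y = (\<Prod>c\<in>Cs. det (mat r r (\<lambda>(p, q). e c p (q + Min c) Y)))" for Y
  have finU: "finite U" and finCs: "finite Cs"
    using fin by (auto simp: U_def Cs_def)
  have poly_e: "boolean_poly 1 (e c p q)" for c p q
  proof -
    have "boolean_poly (1 + 0) (\<lambda>Y. of_bool ({w} \<subseteq> Y) * B (snd w) $$ (p, q))" for w :: "nat \<times> nat"
      by (intro boolean_poly_mult boolean_poly_monom boolean_poly_const) auto
    then have "boolean_poly 1 (\<lambda>Y. e c p q Y)"
      unfolding e_def by (intro boolean_poly_sum) simp
    then show ?thesis by simp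
  qed
  have e_eq: "e c p q Y = matrix_sum n (B \<circ> snd) {w \<in> Y. fst w \<in> c} $$ (p, q)"
    if "Y \<subseteq> U" "p < n" "q < n" for c p q Y
  proof -
    have "e c p q Y = (\<Sum>w | w \<in> Y \<and> fst w \<in> c. B (snd w) $$ (p, q))"
      unfolding e_def using that finU by (intro sum.mono_neutral_cong_right) auto
    then show ?thesis using that by (simp add: matrix_sum_def)
  qed
  have "boolean_poly (\<Sum>c\<in>Cs. r) P"
    unfolding P_def using finCs poly_e by (intro boolean_poly_prod boolean_poly_det)
  moreover have "(\<Sum>c\<in>Cs. r) = (2 ^ k - 1) * r"
    by (simp add: Cs_def card_Diff_singleton card_Pow)
  moreover have "\<dots> \<le> (2 ^ k - 1) * n"
    by (simp add: r_def)
  ultimately have poly_P: "boolean_poly ((2 ^ k - 1) * n) P"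
    using boolean_poly_mono by metis

  \<comment> \<open>The \<open>j\<close>-th power of the shift has its ones on the
    \<open>j\<close>-th superdiagonal. \<open>Z j\<close> is its expansion in \<open>B\<close>, and
    \<open>Y\<^sub>0\<close> collects these expansions.\<close>
  have "\<forall>j. \<exists>Z\<subseteq>I. mat n n (\<lambda>(p, q). of_bool (q = p + j)) = matrix_sum n B Z"
    by (intro allI spanning) simp
  then obtain Z where Z: "\<And>j. Z j \<subseteq> I"
      "\<And>j. mat n n (\<lambda>(p, q). of_bool (q = p + j)) = matrix_sum n B (Z j)"
    by metis
  define Y\<^sub>0 where "Y\<^sub>0 = Sigma {..<k} Z"
  have Y\<^sub>0: "Y\<^sub>0 \<subseteq> U"
    using Z(1) by (auto simp: Y\<^sub>0_def U_def)
  have finZ: "finite (Z j)" for j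
    using Z(1) fin finite_subset by blast
  have e_Y\<^sub>0: "e c p q Y\<^sub>0 = of_bool (p \<le> q \<and> q - p \<in> c)" if "c \<subseteq> {..<k}" "p < n" "q < n" for c p q
  proof -
    have finc: "finite c" using that finite_subset by blast
    have "{w \<in> Y\<^sub>0. fst w \<in> c} = Sigma c Z"
      using that by (auto simp: Y\<^sub>0_def)
    then have "e c p q Y\<^sub>0 = (\<Sum>w\<in>Sigma c Z. B (snd w) $$ (p, q))"
      using e_eq[OF Y\<^sub>0 that(2,3)] that by (simp add: matrix_sum_def)
    also have "\<dots> = (\<Sum>j\<in>c. \<Sum>i\<in>Z j. B i $$ (p, q))"
      using finc finZ by (simp add: sum.Sigma case_prod_unfold)
    also have "\<dots> = (\<Sum>j\<in>c. matrix_sum n B (Z j) $$ (p, q))"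
      using that by (simp add: matrix_sum_def)
    also have "\<dots> = (\<Sum>j\<in>c. of_bool (q = p + j))"
      using that by (simp flip: Z(2))
    \<comment> \<open>The guard \<open>p \<le> q\<close> is there because \<open>q - p\<close> is
      truncated to 0 below the diagonal.\<close>
    also have "\<dots> = (\<Sum>j\<in>c. if j = q - p then of_bool (p \<le> q) else 0)"
      by (intro sum.cong) auto
    also have "\<dots> = of_bool (p \<le> q \<and> q - p \<in> c)"
      using finc by (simp add: sum.delta)
    finally show ?thesis .
  qed
  have "P Y\<^sub>0 = 1"
    unfolding P_def
  proof (rule prod.neutral, rule ballI)
    fix c assume "c \<in> Cs"
    then have c: "c \<subseteq> {..<k}" "c \<noteq> {}" "finite c"
      using finite_subset by (auto simp: Cs_def)
    then have Min: "Min c \<in> c" "Min c < k" "\<And>x. x \<in> c \<Longrightarrow> Min c \<le> x"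
      using Min_in by auto
    show "det (mat r r (\<lambda>(p, q). e c p (q + Min c) Y\<^sub>0)) = 1"
    proof (rule det_unit_upper_triangular)
      \<comment> \<open>Below the diagonal \<open>q + Min c - p\<close> is either truncated or
        smaller than \<open>Min c\<close>, so the entry is 0.\<close>
      fix p q assume "p < r" "q < p"
      then show "e c p (q + Min c) Y\<^sub>0 = 0"
        using e_Y\<^sub>0[OF c(1), of p "q + Min c"] Min(2) Min(3)[of "q + Min c - p"]
        by (auto simp: r_def)
    next
      fix p assume "p < r"
      then show "e c p (p + Min c) Y\<^sub>0 = 1"
        using e_Y\<^sub>0[OF c(1), of p "p + Min c"] Min by (auto simp: r_def)
    qed
  qed
  then obtain Y where Y: "Y \<subseteq> Y\<^sub>0" "card Y \<le> (2 ^ k - 1) * n" "P Y \<noteq> 0"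
    using boolean_poly_nonzero_small[OF poly_P, of Y\<^sub>0] Y\<^sub>0 finU finite_subset by auto
  then have YU: "Y \<subseteq> U" using Y\<^sub>0 by blast
  show thesis
  proof (rule that)
    fix c assume c: "c \<subseteq> {..<k}" "c \<noteq> {}"
    let ?X = "matrix_sum n (B \<circ> snd) {w \<in> Y. fst w \<in> c}"
    have "finite c" using c finite_subset by blast
    then have "Min c \<in> c" using c by (intro Min_in)
    then have Min: "Min c < k" using c by auto
    show "n - k \<le> vec_space.rank n ?X"
    \<comment> \<open>For \<open>k > n\<close> truncation gives \<open>n - k = 0\<close>, and the
      rank bound is trivial.\<close>
    proof (cases "k \<le> n")
      case True
      have "det (mat r r (\<lambda>(p, q). e c p (q + Min c) Y)) \<noteq> 0"
        using Y(3) c finCs unfolding P_def by (auto simp: Cs_def)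
      also have "mat r r (\<lambda>(p, q). e c p (q + Min c) Y) = mat r r (\<lambda>(p, q). ?X $$ (p, q + Min c))"
        using Min e_eq[OF YU] by (intro eq_matI) (auto simp: r_def)
      finally have "r \<le> vec_space.rank n ?X"
        using Min True by (intro rank_ge_shifted_minor[where l = "Min c"]) (auto simp: r_def)
      then show ?thesis by (simp add: r_def)
    qed simp
  qed (use Y YU in \<open>auto simp: U_def\<close>)
qed

text \<open>A nonzero entry is a nonvanishing minor of size one. With the weight bound this makes
  the code injective.\<close>

lemma rank_pos_if_nonzero:
  fixes a :: "'a::field mat"
  assumes a: "a \<in> carrier_mat n n" "a \<noteq> 0\<^sub>m n n"
  shows "0 < vec_space.rank n a"
proof -
  obtain p q where pq: "p < n" "q < n" "a $$ (p, q) \<noteq> 0"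
    using a by (metis carrier_matD eq_matI index_zero_mat)
  have sets: "{i. i < n \<and> i \<in> {p}} = {p}" "{j. j < n \<and> j \<in> {q}} = {q}"
    using pq by auto
  have carr: "submatrix a {p} {q} \<in> carrier_mat 1 1"
    using a sets by (intro carrier_matI) (simp_all add: dim_submatrix)
  have empty: "{x \<in> {p}. x < p} = {}" "{x \<in> {q}. x < q} = {}" by auto
  have "submatrix a {p} {q} $$ (card {x \<in> {p}. x < p}, card {x \<in> {q}. x < q}) = a $$ (p, q)"
    using a pq by (intro submatrix_index_card) auto
  then have "submatrix a {p} {q} $$ (0, 0) = a $$ (p, q)"
    by (simp only: empty card.empty)
  then have "det (submatrix a {p} {q}) \<noteq> 0"
    using det_single[of "submatrix a {p} {q}"] carr pq by simp
  then have "card {j. j < n \<and> j \<in> {q}} \<le> vec_space.rank n a"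
    by (rule vec_space.rank_gt_minor[OF a(1)])
  then show ?thesis by (simp only: sets) simp
qed

section \<open>Plotkin's argument for the code\<close>

text \<open>Divided by 2^k, the bound reads: m is at least n^2 + 2 (1 - 2^(-k)) n (n - k) - (2^k -
  1) n.\<close>

lemma linear_code_length_bound:
  assumes "linear_code_of_matrices n m \<Gamma>"
  shows "2 * ((2 ^ k - 1) * (n * (n - k))) + 2 ^ k * (n * n) \<le> 2 ^ k * (m + (2 ^ k - 1) * n)"
proof -
  have hom: "\<Gamma> \<in> LinearCombinations.module_hom class_ring (module_mat TYPE(bit) n n) (module_vec TYPE(bit) m)"
    and rank: "\<And>a. a \<in> carrier_mat n n \<Longrightarrow> n * vec_space.rank n a \<le> weight (\<Gamma> a)"
    using assms unfolding linear_code_of_matrices_def linear_map_def mod_hom_def mod_hom_axioms_def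
    by auto
  have dim: "dim_vec (\<Gamma> a) = m" if "a \<in> carrier_mat n n" for a
    using hom that funcset_mem[of \<Gamma> "carrier_mat n n" "carrier_vec m" a]
    by (auto simp: LinearCombinations.module_hom_def module_mat_simps module_vec_simps)
  have add: "\<Gamma> (a + b) = \<Gamma> a + \<Gamma> b" if "a \<in> carrier_mat n n" "b \<in> carrier_mat n n" for a b
    using hom that by (auto simp: LinearCombinations.module_hom_def module_mat_simps module_vec_simps)
  define g where "g i a = \<Gamma> a $ i" for i a
  have g_add: "additive_on_matrices n (g i)" if "i < m" for i
    using that by (auto simp: additive_on_matrices_def g_def add dim)
  have weight: "weight (\<Gamma> a) = card {i. i < m \<and> g i a \<noteq> 0}" if "a \<in> carrier_mat n n" for a
    using dim[OF that] by (simp add: weight_def g_def)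
  have g_inj: "a = 0\<^sub>m n n" if a: "a \<in> carrier_mat n n" "\<And>i. i < m \<Longrightarrow> g i a = 0" for a
  \<comment> \<open>For \<open>n = 0\<close> the weight bound is void, but the empty matrix is the
    only one.\<close>
  proof (cases "n = 0")
    case True
    then show ?thesis using a(1) by auto
  next
    case False
    have "{i. i < m \<and> g i a \<noteq> 0} = {}" using a by auto
    then have "weight (\<Gamma> a) = 0" using weight[OF a(1)] by (metis card.empty)
    then have "vec_space.rank n a = 0" using rank[OF a(1)] False by simp
    then show ?thesis using rank_pos_if_nonzero[OF a(1)] by auto
  qed
  obtain I B where IB: "I \<subseteq> {..<m}" "n * n \<le> card I"
    "\<And>i. i \<in> I \<Longrightarrow> B i \<in> carrier_mat n n"
    "\<And>i j. i \<in> I \<Longrightarrow> j \<in> I \<Longrightarrow> g j (B i) = of_bool (i = j)"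
    "\<And>a. a \<in> carrier_mat n n \<Longrightarrow> a = matrix_sum n B {i \<in> I. g i a \<noteq> 0}"
  proof (rule information_set_exists[of m n g])
    show "additive_on_matrices n (g i)" if "i < m" for i
      using that by (rule g_add)
    show "a = 0\<^sub>m n n" if "a \<in> carrier_mat n n" "\<And>i. i < m \<Longrightarrow> g i a = 0" for a
      using that by (rule g_inj)
  qed blast
  have finI: "finite I" using IB(1) finite_subset by blast
  have "\<exists>Z\<subseteq>I. a = matrix_sum n B Z" if "a \<in> carrier_mat n n" for a
    by (rule exI[of _ "{i \<in> I. g i a \<noteq> 0}"]) (intro conjI Collect_subset IB(5)[OF that])
  then obtain Y where Y: "Y \<subseteq> {..<k} \<times> I" "card Y \<le> (2 ^ k - 1) * n"
    "\<And>c. c \<subseteq> {..<k} \<Longrightarrow> c \<noteq> {} \<Longrightarrow>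
      n - k \<le> vec_space.rank n (matrix_sum n (B \<circ> snd) {w \<in> Y. fst w \<in> c})"
    by (rule sparse_high_rank_family[OF finI, of n B k]) blast+
  have finY: "finite Y" using Y(1) finI finite_subset by blast
  define X where "X c = matrix_sum n (B \<circ> snd) {w \<in> Y. fst w \<in> c}" for c
  define Cs where "Cs = Pow {..<k} - {{}}"
  have finCs: "finite Cs" and cardCs: "card Cs = 2 ^ k - 1"
    by (auto simp: Cs_def card_Diff_singleton card_Pow)
  \<comment> \<open>The coordinates left out are those \<open>i\<close> in \<open>I\<close> for
    which \<open>B i\<close> is never a summand; by duality every \<open>X c\<close> vanishes
    there.\<close>
  define R where "R = {..<m} - (I - snd ` Y)"
  have g_X: "g i (X c) = (\<Sum>w | w \<in> Y \<and> fst w \<in> c. g i (B (snd w)))" if "i < m" for i c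
    unfolding X_def using Y(1) finY IB(3) by (subst additive_on_matrices_sum[OF g_add[OF that]]) auto
  have vanish: "g i (X c) = 0" if "i \<in> I" "i \<notin> snd ` Y" for i c
  proof -
    have "g i (B (snd w)) = 0" if w: "w \<in> Y" for w
    proof -
      have "snd w \<in> I" "snd w \<noteq> i"
        using w Y(1) \<open>i \<notin> snd ` Y\<close> by auto
      then show ?thesis using IB(4) \<open>i \<in> I\<close> by simp
    qed
    then show ?thesis using g_X[of i c] that IB(1) by auto
  qed
  have half: "2 * card {c \<in> Cs. g i (X c) \<noteq> 0} \<le> 2 ^ k" if "i < m" for i
  proof -
    \<comment> \<open>\<open>v j\<close> is coordinate \<open>i\<close> of the \<open>j\<close>-th
      matrix, so coordinate \<open>i\<close> of \<open>X c\<close> is the parity of \<open>v\<close>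
      over \<open>c\<close>.\<close>
    define v where "v j = (\<Sum>w | w \<in> Y \<and> fst w = j. g i (B (snd w)))" for j
    have "g i (X c) = (\<Sum>j\<in>c. v j)" if "c \<subseteq> {..<k}" for c
    proof -
      have "finite c" using that finite_subset by blast
      have "(\<Sum>j\<in>c. v j) = (\<Sum>j\<in>c. \<Sum>w | w \<in> {w \<in> Y. fst w \<in> c} \<and> fst w = j. g i (B (snd w)))"
        unfolding v_def by (intro sum.cong) auto
      also have "\<dots> = (\<Sum>w | w \<in> Y \<and> fst w \<in> c. g i (B (snd w)))"
        using finY \<open>finite c\<close> by (intro sum.group) auto
      finally show ?thesis using g_X[OF \<open>i < m\<close>] by simp
    qed
    then have "{c \<in> Cs. g i (X c) \<noteq> 0} \<subseteq> {c \<in> Pow {..<k}. (\<Sum>j\<in>c. v j) \<noteq> 0}"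
      by (auto simp: Cs_def)
    then have "card {c \<in> Cs. g i (X c) \<noteq> 0} \<le> card {c \<in> Pow {..<k}. (\<Sum>j\<in>c. v j) \<noteq> 0}"
      by (intro card_mono) auto
    then show ?thesis
      using card_odd_subsets_le[of "{..<k}" v] by simp
  qed
  \<comment> \<open>The total weight of the words of all \<open>X c\<close> is counted twice: by
    words, using the rank bound, and by coordinates, using \<open>half\<close>.\<close>
  have "(2 ^ k - 1) * (n * (n - k)) = (\<Sum>c\<in>Cs. n * (n - k))"
    by (simp add: cardCs)
  also have "\<dots> \<le> (\<Sum>c\<in>Cs. card {i \<in> R. g i (X c) \<noteq> 0})"
  proof (rule sum_mono)
    fix c assume "c \<in> Cs"
    then have "n * (n - k) \<le> n * vec_space.rank n (X c)"
      using Y(3)[of c] by (auto simp: X_def Cs_def)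
    also have "\<dots> \<le> weight (\<Gamma> (X c))"
      by (rule rank) (simp add: X_def)
    also have "\<dots> = card {i. i < m \<and> g i (X c) \<noteq> 0}"
      by (rule weight) (simp add: X_def)
    also have "{i. i < m \<and> g i (X c) \<noteq> 0} = {i \<in> R. g i (X c) \<noteq> 0}"
      using vanish[of _ c] unfolding R_def by blast
    finally show "n * (n - k) \<le> card {i \<in> R. g i (X c) \<noteq> 0}" .
  qed
  also have "\<dots> = (\<Sum>i\<in>R. card {c \<in> Cs. g i (X c) \<noteq> 0})"
    using finCs by (intro sum_multicount_gen) (auto simp: R_def)
  finally have "2 * ((2 ^ k - 1) * (n * (n - k))) \<le> (\<Sum>i\<in>R. 2 * card {c \<in> Cs. g i (X c) \<noteq> 0})"
    by (simp flip: sum_distrib_left)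
  also have "\<dots> \<le> (\<Sum>i\<in>R. 2 ^ k)"
    using half by (intro sum_mono) (auto simp: R_def)
  also have "\<dots> = 2 ^ k * card R" by simp
  finally have "2 * ((2 ^ k - 1) * (n * (n - k))) \<le> 2 ^ k * card R" .
  moreover have "card R + n * n \<le> m + (2 ^ k - 1) * n"
  proof -
    have "I - snd ` Y \<subseteq> {..<m}" using IB(1) by blast
    then have "card R + card (I - snd ` Y) = m"
      using card_Diff_subset[of "I - snd ` Y" "{..<m}"] finI
        card_mono[of "{..<m}" "I - snd ` Y"] by (simp add: R_def)
    moreover have "card I - card (snd ` Y) \<le> card (I - snd ` Y)"
      using finY by (intro diff_card_le_card_Diff) auto
    moreover have "card (snd ` Y) \<le> (2 ^ k - 1) * n"
      using card_image_le[OF finY, of snd] Y(2) by linarith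
    ultimately show ?thesis using IB(2) by linarith
  qed
  then have "2 ^ k * (card R + n * n) \<le> 2 ^ k * (m + (2 ^ k - 1) * n)"
    by (rule mult_left_mono) simp
  ultimately show ?thesis by (simp add: distrib_left)
qed

section \<open>Choice of \<open>k\<close> and the final estimate\<close>

theorem theorem3:
  shows "\<exists>C::real. \<forall>(n::nat) (m::nat) (\<Gamma> :: bit mat \<Rightarrow> bit vec).
    n \<ge> 1 \<longrightarrow> linear_code_of_matrices n m \<Gamma> \<longrightarrow>
    real m \<ge> 3 * real n ^ 2 - C * real n powr (5 / 3)"
proof (intro exI[of _ 7] allI impI)
  fix n m :: nat and \<Gamma> :: "bit mat \<Rightarrow> bit vec"
  assume n: "n \<ge> 1" and \<Gamma>: "linear_code_of_matrices n m \<Gamma>"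
  \<comment> \<open>This makes 2^k agree with the square root of n up to a factor 2, balancing the
    averaging loss 2 n^2 / 2^k against the 2^k n exceptional coordinates.\<close>
  obtain k where k: "4 ^ k \<le> n" "n < 4 ^ (k + 1)"
    using ex_power_ivl1[of 4 n] n by auto
  define s x where "s = sqrt (real n)" and "x = (2::real) ^ k"
  have s: "s \<ge> 1" "s ^ 2 = real n"
    using n by (auto simp: s_def)
  have x1: "x \<ge> 1" by (simp add: x_def)
  have "x ^ 2 = 4 ^ k"
    by (simp add: x_def power2_eq_square flip: power_mult_distrib)
  also have "(4::real) ^ k \<le> s ^ 2"
    using k(1) s(2) by (metis of_nat_le_iff of_nat_numeral of_nat_power)
  finally have xs: "x \<le> s"
    by (rule power2_le_imp_le) (use s(1) in linarith)
  have "real n < real (4 ^ (k + 1))"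
    using k(2) of_nat_less_iff by blast
  then have "s ^ 2 < (2 * x) ^ 2"
    using \<open>x ^ 2 = 4 ^ k\<close> s(2) by (simp add: power_mult_distrib)
  then have sx: "s < 2 * x"
    using x1 by (intro power_less_imp_less_base[of s 2]) auto
  have kx: "real k \<le> x"
    unfolding x_def using of_nat_less_two_power[of k, where 'a = real] by simp
  have "x \<le> x ^ 2" using x1 by (simp add: power2_eq_square)
  have "real k \<le> real n"
    using kx \<open>x \<le> x ^ 2\<close> \<open>x ^ 2 = 4 ^ k\<close> \<open>(4::real) ^ k \<le> s ^ 2\<close> s(2) by linarith
  then have nk: "real (n - k) = real n - real k" by simp
  have p: "real (2 ^ k - 1) = x - 1"
    by (simp add: x_def of_nat_diff)
  have "real (2 * ((2 ^ k - 1) * (n * (n - k))) + 2 ^ k * (n * n)) \<le> real (2 ^ k * (m + (2 ^ k - 1) * n))"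
    using linear_code_length_bound[OF \<Gamma>, of k] of_nat_le_iff by blast
  then have main: "2 * ((x - 1) * (s\<^sup>2 * (s\<^sup>2 - real k))) + x * (s\<^sup>2 * s\<^sup>2) \<le> x * (real m + (x - 1) * s\<^sup>2)"
    by (simp only: of_nat_add of_nat_mult nk p s(2)) (simp add: x_def)
  \<comment> \<open>7 = 4 + 2 + 1: the losses 2 s^4, 2 x s^2 k and x^2 s^2 are at most 4, 2 and 1
    times x s^3.\<close>
  have "x * (3 * s ^ 4 - 7 * s ^ 3) \<le> x * real m"
  proof -
    have a: "x * (x * s\<^sup>2) \<le> x * (s * s\<^sup>2)" using xs x1 by (intro mult_mono) auto
    have b: "x * (s\<^sup>2 * real k) \<le> x * (s\<^sup>2 * s)" using xs kx x1 by (intro mult_mono) auto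
    have c: "s * s ^ 3 \<le> 2 * x * s ^ 3" using sx s(1) by (intro mult_right_mono) auto
    have d: "0 \<le> s\<^sup>2 * real k" "0 \<le> x * s\<^sup>2" using x1 by auto
    show ?thesis
      using main a b c d by (simp add: algebra_simps power2_eq_square power3_eq_cube power4_eq_xxxx)
  qed
  then have bound: "3 * s ^ 4 - 7 * s ^ 3 \<le> real m"
    using x1 by simp
  have "s ^ 3 = real n powr (3 / 2)"
    using n by (simp add: s_def powr_half_sqrt[symmetric] powr_powr flip: powr_realpow)
  \<comment> \<open>The error obtained has exponent 3/2; it is weakened to 5/3 using
    \<open>n \<ge> 1\<close>.\<close>
  also have "\<dots> \<le> real n powr (5 / 3)"
    using n by (intro powr_mono) auto
  finally have "s ^ 3 \<le> real n powr (5 / 3)" .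
  moreover have "s ^ 4 = real n ^ 2"
    using s(2) by (metis mult_2 numeral_Bit0 power_mult power_even_eq)
  ultimately show "3 * real n ^ 2 - 7 * real n powr (5 / 3) \<le> real m"
    using bound by simp
qed

end
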